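(* Let $\theta>0$ and set $\tau(\mu):=(1+\mu)\theta$ for $\mu>0$. Then for every $x\in\mathcal{X}$, $$\lim_{\mu\to\infty}\mathbb{E}\left[\psi_{ss}^{\mu,\tau(\mu)}(Z(x))\right]=\mathbb{P}(Z(x)>0).$$
   Context: $(\Omega,\mathcal{F},\mathbb{P})$ is a probability space and $\Xi:\Omega\to\mathbb{R}^d$ is a random vector. $\mathcal{X}=\{x\in\mathbb{R}^n : g(x)\ge 0\}$ is nonempty and compact, with $g:\mathbb{R}^n\to\mathbb{R}^m$ twice differentiable. The scalar function $f(x,\xi)$, $x\in\mathbb{R}^n$, $\xi\in\mathbb{R}^d$, is real-valued and twice continuously differentiable. $Z(x):=f(x,\Xi)$ is the resulting scalar random variable, with cumulative distribution function $F_{Z(x)}(t)=\mathbb{P}(Z(x)\le t)$. Write $[a]_+:=\max\{a,0\}$ and $$\psi_{ss}^{\mu,\tau}(z):=\left[2\,\frac{1+\mu}{\mu+e^{-\tau z}}-1\right]_+,\qquad z\in\mathbb{R}.$$ Standing assumption: there exists $\kappa>0$ such that, for every $x\in\mathcal{X}$, $F_{Z(x)}(t)$ is Lipschitz continuous in $t\in[-\kappa,\kappa]$. *)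

theory Defs
  imports "HOL-Probability.Probability"
begin

definition twice_differentiable ::
  "('a::real_normed_vector \<Rightarrow> 'b::real_normed_vector) \<Rightarrow> bool" where
  "twice_differentiable h \<longleftrightarrow>
     (\<exists>h' :: 'a \<Rightarrow> ('a \<Rightarrow>\<^sub>L 'b).
        (\<forall>x. (h has_derivative blinfun_apply (h' x)) (at x)) \<and>
        (\<forall>x. h' differentiable (at x)))"

definition twice_continuously_differentiable ::
  "('a::real_normed_vector \<Rightarrow> 'b::real_normed_vector) \<Rightarrow> bool" where
  "twice_continuously_differentiable h \<longleftrightarrow>
     (\<exists>(h' :: 'a \<Rightarrow> ('a \<Rightarrow>\<^sub>L 'b)) (h'' :: 'a \<Rightarrow> ('a \<Rightarrow>\<^sub>L ('a \<Rightarrow>\<^sub>L 'b))).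
        (\<forall>x. (h has_derivative blinfun_apply (h' x)) (at x)) \<and>
        (\<forall>x. (h' has_derivative blinfun_apply (h'' x)) (at x)) \<and>
        continuous_on UNIV h'')"

definition feasible_set :: "(real ^ 'n \<Rightarrow> real ^ 'm) \<Rightarrow> (real ^ 'n) set" where
  "feasible_set g = {x. \<forall>i. g x $ i \<ge> 0}"

definition psi_ss :: "real \<Rightarrow> real \<Rightarrow> real \<Rightarrow> real" where
  "psi_ss \<mu> \<tau> z = max (2 * ((1 + \<mu>) / (\<mu> + exp (- \<tau> * z))) - 1) 0"

end

theory Submission
  imports Defs "HOL-Real_Asymp.Real_Asymp"
begin

text \<open>
  Along \<open>\<tau> = (1 + \<mu>) \<theta>\<close> the function \<open>psi_ss \<mu> \<tau>\<close> tends pointwise to the indicator of the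
  positive half-line, except at \<open>0\<close>, where it is constantly \<open>1\<close>. The exponential
  \<open>exp (- (1 + \<mu>) \<theta> z)\<close> vanishes for \<open>z > 0\<close> and outgrows the factor \<open>1 + \<mu>\<close> for \<open>z < 0\<close>
  (lemmas \<open>tendsto_psi_ss_pos\<close> and \<open>tendsto_psi_ss_neg\<close>). Since all values lie in \<open>[0, 3]\<close> once
  \<open>\<mu> \<ge> 1\<close>, dominated convergence yields the limit of the expectations for every random variable
  that avoids the exceptional point \<open>0\<close> almost surely (lemma \<open>tendsto_expectation_psi_ss\<close>).

  The Lipschitz condition secures this last proviso for \<open>f x \<circ> \<Xi>\<close>: its distribution function is
  continuous at \<open>0\<close>, so it has no atom there (lemma \<open>AE_neq_if_isCont_cdf\<close>). Its measurability
  comes from the continuity of \<open>f\<close>.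
\<close>

lemma borel_measurable_psi_ss [measurable]: "psi_ss \<mu> \<tau> \<in> borel_measurable borel"
  unfolding psi_ss_def by measurable

lemma psi_ss_nonneg: "psi_ss \<mu> \<tau> z \<ge> 0"
  unfolding psi_ss_def by simp

text \<open>The denominator is at least \<open>\<mu>\<close>, so the value is at most \<open>1 + 2 / \<mu>\<close>, whatever \<open>\<tau>\<close> is.
  This uniformity is what allows \<open>\<tau>\<close> to vary with \<open>\<mu>\<close> under dominated convergence.\<close>

lemma psi_ss_le_3:
  assumes "\<mu> \<ge> 1"
  shows "psi_ss \<mu> \<tau> z \<le> 3"
proof -
  define e where "e = exp (- \<tau> * z)"
  have "e > 0"
    by (simp add: e_def)
  with assms have "(1 + \<mu>) / (\<mu> + e) \<le> 2"
    by (simp add: pos_divide_le_eq)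
  then show ?thesis
    unfolding psi_ss_def e_def by linarith
qed

lemma tendsto_psi_ss_pos:
  assumes "\<theta> > 0" "z > 0"
  shows "((\<lambda>\<mu>. psi_ss \<mu> ((1 + \<mu>) * \<theta>) z) \<longlongrightarrow> 1) at_top"
proof -
  \<comment> \<open>The asymptotics depend on the sign of this product alone, which is abstracted to a parameter.\<close>
  define c where "c = \<theta> * z"
  have "c > 0"
    using assms by (simp add: c_def)
  then have "((\<lambda>\<mu>. max (2 * ((1 + \<mu>) / (\<mu> + exp (- ((1 + \<mu>) * c)))) - 1) 0) \<longlongrightarrow> 1) at_top"
    by real_asymp
  then show ?thesis
    unfolding psi_ss_def c_def by (simp add: mult.assoc)
qed

lemma tendsto_psi_ss_neg:
  assumes "\<theta> > 0" "z < 0"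
  shows "((\<lambda>\<mu>. psi_ss \<mu> ((1 + \<mu>) * \<theta>) z) \<longlongrightarrow> 0) at_top"
proof -
  \<comment> \<open>The asymptotics depend on the sign of this product alone, which is abstracted to a parameter.\<close>
  define c where "c = \<theta> * z"
  have "c < 0"
    using assms by (simp add: c_def mult_pos_neg)
  then have "((\<lambda>\<mu>. max (2 * ((1 + \<mu>) / (\<mu> + exp (- ((1 + \<mu>) * c)))) - 1) 0) \<longlongrightarrow> 0) at_top"
    by real_asymp
  then show ?thesis
    unfolding psi_ss_def c_def by (simp add: mult.assoc)
qed

lemma (in prob_space) tendsto_expectation_psi_ss:
  fixes X :: "'a \<Rightarrow> real"
  assumes [measurable]: "X \<in> borel_measurable M"
    and nonzero: "AE \<omega> in M. X \<omega> \<noteq> 0"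
    and "\<theta> > 0"
  shows "((\<lambda>\<mu>. expectation (\<lambda>\<omega>. psi_ss \<mu> ((1 + \<mu>) * \<theta>) (X \<omega>)))
           \<longlongrightarrow> prob {\<omega> \<in> space M. X \<omega> > 0}) at_top"
proof -
  let ?I = "indicator {0<..} :: real \<Rightarrow> real"
  have pointwise: "((\<lambda>\<mu>. psi_ss \<mu> ((1 + \<mu>) * \<theta>) z) \<longlongrightarrow> ?I z) at_top" if "z \<noteq> 0" for z
    using that tendsto_psi_ss_pos[OF \<open>\<theta> > 0\<close>, of z] tendsto_psi_ss_neg[OF \<open>\<theta> > 0\<close>, of z]
    by (cases "z > 0") auto
  have "((\<lambda>\<mu>. expectation (\<lambda>\<omega>. psi_ss \<mu> ((1 + \<mu>) * \<theta>) (X \<omega>)))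
          \<longlongrightarrow> expectation (\<lambda>\<omega>. ?I (X \<omega>))) at_top"
  proof (rule integral_dominated_convergence_at_top[where w = "\<lambda>_. 3"])
    show "\<forall>\<^sub>F \<mu> in at_top. AE \<omega> in M. norm (psi_ss \<mu> ((1 + \<mu>) * \<theta>) (X \<omega>)) \<le> 3"
      using eventually_ge_at_top[of "1::real"]
      by eventually_elim (simp add: psi_ss_nonneg psi_ss_le_3)
    show "AE \<omega> in M. ((\<lambda>\<mu>. psi_ss \<mu> ((1 + \<mu>) * \<theta>) (X \<omega>)) \<longlongrightarrow> ?I (X \<omega>)) at_top"
      using nonzero by eventually_elim (rule pointwise)
  qed simp_all
  also have "expectation (\<lambda>\<omega>. ?I (X \<omega>)) = expectation (indicator {\<omega> \<in> space M. X \<omega> > 0})"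
    by (rule Bochner_Integration.integral_cong) (auto simp: indicator_def)
  also have "\<dots> = prob {\<omega> \<in> space M. X \<omega> > 0}"
    by simp
  finally show ?thesis .
qed

text \<open>The size of the jump of a distribution function at \<open>c\<close> is the mass of the atom at \<open>c\<close>.\<close>

lemma (in prob_space) AE_neq_if_isCont_cdf:
  fixes X :: "'a \<Rightarrow> real"
  assumes [measurable]: "X \<in> borel_measurable M"
    and "isCont (cdf (distr M borel X)) c"
  shows "AE \<omega> in M. X \<omega> \<noteq> c"
proof -
  interpret X: real_distribution "distr M borel X"
    by (rule real_distribution_distr) simp
  have "measure (distr M borel X) {c} = 0"
    using assms(2) by (simp add: X.isCont_cdf)
  then have "prob (X -` {c} \<inter> space M) = 0"
    by (simp add: measure_distr)
  then have "prob {\<omega> \<in> space M. \<not> X \<omega> \<noteq> c} = 0"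
    by (simp add: vimage_def Int_def conj_commute)
  then show ?thesis
    by (subst AE_iff_measurable[OF _ refl]) (simp_all add: emeasure_eq_measure)
qed

lemma twice_continuously_differentiable_imp_continuous_on:
  assumes "twice_continuously_differentiable h"
  shows "continuous_on A h"
  using assms unfolding twice_continuously_differentiable_def
  by (meson continuous_at_imp_continuous_on has_derivative_continuous)

theorem theorem1:
  fixes M :: "'w measure"
    and \<Xi> :: "'w \<Rightarrow> real ^ 'd"
    and g :: "real ^ 'n \<Rightarrow> real ^ 'm"
    and f :: "real ^ 'n \<Rightarrow> real ^ 'd \<Rightarrow> real"
    and \<theta> :: real
  assumes "prob_space M"
    and "\<Xi> \<in> borel_measurable M"
    and "twice_differentiable g"
    and "feasible_set g \<noteq> {}"
    and "compact (feasible_set g)"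
    and "twice_continuously_differentiable (\<lambda>(x, \<xi>). f x \<xi>)"
    and "\<exists>\<kappa>>0. \<forall>x\<in>feasible_set g. \<exists>L.
           L-lipschitz_on {-\<kappa>..\<kappa>} (cdf (distr M borel (\<lambda>\<omega>. f x (\<Xi> \<omega>))))"
    and "\<theta> > 0"
  shows "\<forall>x\<in>feasible_set g.
           ((\<lambda>\<mu>. \<integral>\<omega>. psi_ss \<mu> ((1 + \<mu>) * \<theta>) (f x (\<Xi> \<omega>)) \<partial>M)
             \<longlongrightarrow> measure M {\<omega> \<in> space M. f x (\<Xi> \<omega>) > 0}) at_top"
proof
  fix x
  assume x: "x \<in> feasible_set g"
  interpret prob_space M by fact
  have "continuous_on UNIV ((\<lambda>(x, \<xi>). f x \<xi>) \<circ> Pair x)"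
    by (intro continuous_on_compose continuous_intros
        twice_continuously_differentiable_imp_continuous_on assms)
  then have "continuous_on UNIV (f x)"
    by (simp add: o_def)
  then have [measurable]: "f x \<in> borel_measurable borel"
    by (rule borel_measurable_continuous_onI)
  note \<open>\<Xi> \<in> borel_measurable M\<close>[measurable]
  have Z: "(\<lambda>\<omega>. f x (\<Xi> \<omega>)) \<in> borel_measurable M"
    by measurable
  obtain \<kappa> L where "\<kappa> > 0"
    and lipschitz: "L-lipschitz_on {-\<kappa>..\<kappa>} (cdf (distr M borel (\<lambda>\<omega>. f x (\<Xi> \<omega>))))"
    using assms(7) x by blast
  have "isCont (cdf (distr M borel (\<lambda>\<omega>. f x (\<Xi> \<omega>)))) 0"
    using lipschitz_on_continuous_on[OF lipschitz]
    by (rule continuous_on_interior) (use \<open>\<kappa> > 0\<close> in simp)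
  from tendsto_expectation_psi_ss[OF Z AE_neq_if_isCont_cdf[OF Z this] \<open>\<theta> > 0\<close>]
  show "((\<lambda>\<mu>. \<integral>\<omega>. psi_ss \<mu> ((1 + \<mu>) * \<theta>) (f x (\<Xi> \<omega>)) \<partial>M)
          \<longlongrightarrow> measure M {\<omega> \<in> space M. f x (\<Xi> \<omega>) > 0}) at_top" .
qed

end
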